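(* Let $k_1,\dots,k_m$ be positive integers with $\sum_{i=1}^mk_i=T$, and let $\tilde k_j=\sum_{i=1}^jk_i$ (with $\tilde k_0=0$). The regret of the Localized Meta-Algorithm run with an admissible relaxation $\mathbf{Rel}$ and blocks $k_1,\dots,k_m$ is bounded as $$\mathbf{Reg}_T(x_1,\dots,x_T)\le\sum_{i=1}^m\mathbf{Rel}_{k_i}\Big(\mathcal F_{r(k_i;x_1,\dots,x_{\tilde k_{i-1}})}\Big).$$
   Context: Online game: $\mathcal F$ (learner's moves) and $\mathcal X$ (Nature's moves) are sets, $\ell:\mathcal F\times\mathcal X\to\mathbb R$ is a loss, $\Delta(A)$ is the set of distributions on $A$. On each round $t=1,\dots,T$ the learner picks $q_t\in\Delta(\mathcal F)$ and plays $f_t\sim q_t$, and Nature simultaneously picks $x_t\in\mathcal X$. The regret is $\mathbf{Reg}_T(x_1,\dots,x_T)=\sum_{t=1}^T\ell(f_t,x_t)-\inf_{f\in\mathcal F}\sum_{t=1}^T\ell(f,x_t)$. It is assumed throughout that $\ell,\mathcal F,\mathcal X$ are such that the minimax theorem in the space of distributions over $\mathcal F$ and $\mathcal X$ holds. Admissible relaxation: for a horizon $k$ and a class $\mathcal G\subseteq\mathcal F$, functions $\mathbf{Rel}_k(\mathcal G\mid z_1,\dots,z_j)$, $0\le j\le k$, $z_i\in\mathcal X$, with $\mathbf{Rel}_k(\mathcal G)$ the value at the empty sequence, such that $\mathbf{Rel}_k(\mathcal G\mid z_{1},\dots,z_j)\ge\inf_{q\in\Delta(\mathcal G)}\sup_{x\in\mathcal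 X}\{\mathbb E_{f\sim q}\ell(f,x)+\mathbf{Rel}_k(\mathcal G\mid z_1,\dots,z_j,x)\}$ for $0\le j\le k-1$, and $\mathbf{Rel}_k(\mathcal G\mid z_1,\dots,z_k)\ge-\inf_{f\in\mathcal G}\sum_{j=1}^k\ell(f,z_j)$. The Meta-Algorithm $\mathbf{MetAlgo}(\mathcal G)$ over $k$ rounds computes, at its $(j+1)$-st round with history $z_1,\dots,z_j$, a $q$ minimizing $\sup_{x\in\mathcal X}\{\mathbb E_{f\sim q}\ell(f,x)+\mathbf{Rel}_k(\mathcal G\mid z_1,\dots,z_j,x)\}$ over $\Delta(\mathcal G)$, and plays $f\sim q$. Localization: $\mathcal F^k(x_1,\dots,x_t)$ is the set of $f\in\mathcal F$ for which there exist $x_{t+1},\dots,x_{t+k}\in\mathcal X$ with $\sum_{i=1}^{t+k}\ell(f,x_i)=\inf_{g\in\mathcal F}\sum_{i=1}^{t+k}\ell(g,x_i)$. Fix a real-valued "property" $P(f\mid x_1,\dots,x_t)$ of $f$ given data; $\mathcal F_r(x_1,\dots,x_t)=\{f\in\mathcal F:P(f\mid x_1,\dots,x_t)\le r\}$, $r(k;x_1,\dots,x_t)=\inf\{r:\mathcal F^k(x_1,\dots,x_t)\subset\mathcal F_r(x_1,\dots,x_t)\}$, and $\mathcal F_{r(k;x_1,\dots,x_t)}$ abbreviates $\mathcal F_{r(k;x_1,\dots,x_t)}(x_1,\dots,x_t)$. Localized Meta-Algorithm: for $i=1,\dots,m$, with $t=\tilde k_{i-1}$ rounds already played, play the next $k_i$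 rounds using $\mathbf{MetAlgo}(\mathcal F_{r(k_i;x_1,\dots,x_t)})$ with horizon $k_i$ (its history being the data of the current block).
   Formalization: The regret is bounded in expectation over the draws f_t ~ q_t (it fails pathwise), and it is assumed that the infimum over F of the cumulative loss on x_1,...,x_{k̃_i} is attained at every block end i=1,...,m; without attainment the bound can fail. *)

theory Defs
  imports "HOL-Probability.Probability"
begin

text \<open>
  The learner's set of moves is the space of a measurable space \<open>M\<close>; only the
  \<open>\<sigma>\<close>-algebra of \<open>M\<close> is used, never its measure. Nature's moves form a set \<open>X\<close>,
  and \<open>l f x\<close> is the loss. Time and block indices start at 1. Infima and suprema
  that may be infinite are taken in \<^typ>\<open>ereal\<close>.
\<close>

definition cum_loss :: "('f \<Rightarrow> 'x \<Rightarrow> real) \<Rightarrow> 'f \<Rightarrow> 'x list \<Rightarrow> real" where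
  "cum_loss l f zs = (\<Sum>z\<leftarrow>zs. l f z)"

text \<open>
  Probability measures on \<open>G\<close> carry the trace \<open>\<sigma>\<close>-algebra, so \<open>G\<close> need not be
  measurable in \<open>M\<close>. Integrability of the losses is required because the Bochner integral
  silently returns 0 otherwise.
\<close>

definition distributions ::
  "'f measure \<Rightarrow> 'x set \<Rightarrow> ('f \<Rightarrow> 'x \<Rightarrow> real) \<Rightarrow> 'f set \<Rightarrow> 'f measure set" where
  "distributions M X l G =
     {q. prob_space q \<and> sets q = sets (restrict_space M G) \<and>
         (\<forall>x\<in>X. integrable q (\<lambda>f. l f x))}"

text \<open>
  \<open>Rel k G [z\<^sub>1, \<dots>, z\<^sub>j]\<close> is the relaxation for horizon \<open>k\<close> and class \<open>G\<close>. Extended real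
  values are allowed: the conditions below force the value \<open>\<infinity>\<close> when \<open>G\<close> is empty.
\<close>

type_synonym ('f, 'x) relaxation = "nat \<Rightarrow> 'f set \<Rightarrow> 'x list \<Rightarrow> ereal"

definition meta_objective ::
  "'x set \<Rightarrow> ('f \<Rightarrow> 'x \<Rightarrow> real) \<Rightarrow> ('x list \<Rightarrow> ereal) \<Rightarrow> 'x list \<Rightarrow> 'f measure \<Rightarrow> ereal" where
  "meta_objective X l R zs q = (SUP x\<in>X. ereal (\<integral>f. l f x \<partial>q) + R (zs @ [x]))"

definition admissible ::
  "'f measure \<Rightarrow> 'x set \<Rightarrow> ('f \<Rightarrow> 'x \<Rightarrow> real) \<Rightarrow> ('f, 'x) relaxation \<Rightarrow> bool" where
  "admissible M X l Rel \<longleftrightarrow>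
     (\<forall>k\<ge>1. \<forall>G\<subseteq>space M. \<forall>zs\<in>lists X.
        (length zs < k \<longrightarrow>
           Rel k G zs \<ge> (INF q\<in>distributions M X l G. meta_objective X l (Rel k G) zs q)) \<and>
        (length zs = k \<longrightarrow>
           Rel k G zs \<ge> - (INF f\<in>G. ereal (cum_loss l f zs))))"

definition met_algo_move ::
  "'f measure \<Rightarrow> 'x set \<Rightarrow> ('f \<Rightarrow> 'x \<Rightarrow> real) \<Rightarrow> ('f, 'x) relaxation \<Rightarrow>
    nat \<Rightarrow> 'f set \<Rightarrow> 'x list \<Rightarrow> 'f measure \<Rightarrow> bool" where
  "met_algo_move M X l Rel k G zs q \<longleftrightarrow>
     is_arg_min (meta_objective X l (Rel k G) zs) (\<lambda>q. q \<in> distributions M X l G) q"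

definition future_minimizers ::
  "'f set \<Rightarrow> 'x set \<Rightarrow> ('f \<Rightarrow> 'x \<Rightarrow> real) \<Rightarrow> nat \<Rightarrow> 'x list \<Rightarrow> 'f set" where
  "future_minimizers F X l k xs =
     {f \<in> F. \<exists>ys\<in>lists X. length ys = k \<and>
        ereal (cum_loss l f (xs @ ys)) = (INF g\<in>F. ereal (cum_loss l g (xs @ ys)))}"

definition sublevel :: "'f set \<Rightarrow> ('f \<Rightarrow> 'x list \<Rightarrow> real) \<Rightarrow> ereal \<Rightarrow> 'x list \<Rightarrow> 'f set" where
  "sublevel F P r xs = {f \<in> F. ereal (P f xs) \<le> r}"

text \<open>
  The infimum ranges over real \<open>r\<close>. It is \<open>\<infinity>\<close>, and the localized class is all of \<open>F\<close>, when
  the property is unbounded above on the future minimizers.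
\<close>

definition local_radius ::
  "'f set \<Rightarrow> 'x set \<Rightarrow> ('f \<Rightarrow> 'x \<Rightarrow> real) \<Rightarrow> ('f \<Rightarrow> 'x list \<Rightarrow> real) \<Rightarrow>
    nat \<Rightarrow> 'x list \<Rightarrow> ereal" where
  "local_radius F X l P k xs =
     Inf {ereal r | r. future_minimizers F X l k xs \<subseteq> sublevel F P (ereal r) xs}"

definition localized_class ::
  "'f set \<Rightarrow> 'x set \<Rightarrow> ('f \<Rightarrow> 'x \<Rightarrow> real) \<Rightarrow> ('f \<Rightarrow> 'x list \<Rightarrow> real) \<Rightarrow>
    nat \<Rightarrow> 'x list \<Rightarrow> 'f set" where
  "localized_class F X l P k xs = sublevel F P (local_radius F X l P k xs) xs"

text \<open>\<open>segment x a b\<close> is the list \<open>x\<^sub>a\<^sub>+\<^sub>1, \<dots>, x\<^sub>b\<close>.\<close>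

definition segment :: "(nat \<Rightarrow> 'x) \<Rightarrow> nat \<Rightarrow> nat \<Rightarrow> 'x list" where
  "segment x a b = map x [Suc a..<Suc b]"

definition block_end :: "(nat \<Rightarrow> nat) \<Rightarrow> nat \<Rightarrow> nat" where
  "block_end k j = (\<Sum>i=1..j. k i)"

definition block_class ::
  "'f set \<Rightarrow> 'x set \<Rightarrow> ('f \<Rightarrow> 'x \<Rightarrow> real) \<Rightarrow> ('f \<Rightarrow> 'x list \<Rightarrow> real) \<Rightarrow>
    (nat \<Rightarrow> nat) \<Rightarrow> (nat \<Rightarrow> 'x) \<Rightarrow> nat \<Rightarrow> 'f set" where
  "block_class F X l P k x i =
     localized_class F X l P (k i) (segment x 0 (block_end k (i - 1)))"

text \<open>
  \<open>q t\<close> is the distribution chosen in round \<open>t\<close> when Nature's moves are \<open>x 1, x 2, \<dots>\<close>. It is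
  constrained only through the past moves \<open>x 1, \<dots>, x (t - 1)\<close>, and when the minimizer is not
  unique any choice is allowed.
\<close>

definition localized_meta_run ::
  "'f measure \<Rightarrow> 'x set \<Rightarrow> ('f \<Rightarrow> 'x \<Rightarrow> real) \<Rightarrow> ('f \<Rightarrow> 'x list \<Rightarrow> real) \<Rightarrow>
    ('f, 'x) relaxation \<Rightarrow> nat \<Rightarrow> (nat \<Rightarrow> nat) \<Rightarrow> (nat \<Rightarrow> 'x) \<Rightarrow> (nat \<Rightarrow> 'f measure) \<Rightarrow> bool" where
  "localized_meta_run M X l P Rel m k x q \<longleftrightarrow>
     (\<forall>i\<in>{1..m}. \<forall>j<k i.
        met_algo_move M X l Rel (k i) (block_class (space M) X l P k x i)
          (segment x (block_end k (i - 1)) (block_end k (i - 1) + j))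
          (q (block_end k (i - 1) + j + 1)))"

text \<open>
  The infimum is a real one: it has its intended meaning only if \<open>F\<close> is nonempty and the
  cumulative losses are bounded below on \<open>F\<close>.
\<close>

definition regret ::
  "'f set \<Rightarrow> ('f \<Rightarrow> 'x \<Rightarrow> real) \<Rightarrow> nat \<Rightarrow> (nat \<Rightarrow> 'f) \<Rightarrow> (nat \<Rightarrow> 'x) \<Rightarrow> real" where
  "regret F l T f x = (\<Sum>t=1..T. l (f t) (x t)) - (INF g\<in>F. \<Sum>t=1..T. l g (x t))"

text \<open>
  For fixed moves of Nature, the learner's draws \<open>f\<^sub>t \<sim> q\<^sub>t\<close> are independent.
\<close>

definition expected_regret ::
  "'f set \<Rightarrow> ('f \<Rightarrow> 'x \<Rightarrow> real) \<Rightarrow> nat \<Rightarrow> (nat \<Rightarrow> 'f measure) \<Rightarrow> (nat \<Rightarrow> 'x) \<Rightarrow> real" where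
  "expected_regret F l T q x = (\<integral>f. regret F l T f x \<partial>(PiM {1..T} q))"

end

theory Submission imports Defs begin

text \<open>
  Within a block the minimax steps of the relaxation telescope, so its initial value dominates
  the expected loss of the block minus the loss of any fixed move \<open>f\<close> of the localized class.
  The minimizer of the cumulative loss at the end of a block belongs to that class, and its
  cumulative loss up to the start of the block is at least the minimum at that time. Hence the
  blocks can be chained by comparing each of them with its own end-of-block minimizer.
\<close>

section \<open>Segments of Nature's moves and the division of the rounds into blocks\<close>

lemma cum_loss_segment: "cum_loss l f (segment x a b) = (\<Sum>t\<in>{a<..b}. l f (x t))"
proof -
  have "cum_loss l f (segment x a b) = (\<Sum>t\<leftarrow>[Suc a..<Suc b]. l f (x t))"
    by (simp add: cum_loss_def segment_def comp_def del: upt_Suc)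
  also have "\<dots> = (\<Sum>t\<in>{Suc a..<Suc b}. l f (x t))"
    by (simp only: interv_sum_list_conv_sum_set_nat set_upt)
  finally show ?thesis
    by (simp only: atLeastLessThanSuc_atLeastAtMost atLeastSucAtMost_greaterThanAtMost)
qed

lemma segment_Suc: "a \<le> b \<Longrightarrow> segment x a (Suc b) = segment x a b @ [x (Suc b)]"
  by (simp add: segment_def)

lemma segment_append:
  assumes "a \<le> b" "b \<le> c"
  shows "segment x a c = segment x a b @ segment x b c"
proof -
  have "[Suc a..<Suc c] = [Suc a..<Suc b] @ [Suc b..<Suc c]"
    using assms upt_add_eq_append[of "Suc a" "Suc b" "c - b"] by simp
  then show ?thesis
    by (simp add: segment_def del: upt_Suc)
qed

lemma length_segment [simp]: "length (segment x a b) = b - a"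
  by (simp add: segment_def del: upt_Suc)

lemma segment_in_lists: "(\<And>t. a < t \<Longrightarrow> t \<le> b \<Longrightarrow> x t \<in> X) \<Longrightarrow> segment x a b \<in> lists X"
  by (auto simp: segment_def simp del: upt_Suc)

lemma block_end_0 [simp]: "block_end k 0 = 0"
  by (simp add: block_end_def)

lemma block_end_Suc [simp]: "block_end k (Suc n) = block_end k n + k (Suc n)"
  by (simp add: block_end_def)

lemma block_end_mono: "i \<le> j \<Longrightarrow> block_end k i \<le> block_end k j"
  by (induction rule: dec_induct) auto

lemma in_some_block:
  assumes "t \<in> {1..block_end k m}"
  obtains i j where "i \<in> {1..m}" "j < k i" "t = block_end k (i - 1) + j + 1"
proof -
  have "\<exists>i\<in>{1..m}. \<exists>j<k i. t = block_end k (i - 1) + j + 1"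
    using assms
  proof (induction m)
    case 0
    then show ?case by simp
  next
    case (Suc m)
    show ?case
    proof (cases "t \<le> block_end k m")
      case True
      with Suc show ?thesis by fastforce
    next
      case False
      \<comment> \<open>Offsets within a block start at 0 while rounds start at 1, hence the
        \<open>- 1\<close>.\<close>
      with Suc.prems have "t - block_end k m - 1 < k (Suc m)"
        "t = block_end k m + (t - block_end k m - 1) + 1" by auto
      then show ?thesis
        by (intro bexI[of _ "Suc m"]) auto
    qed
  qed
  then show thesis using that by blast
qed

section \<open>Future minimizers and localized classes\<close>

lemma future_minimizers_subset_localized_class:
  "future_minimizers F X l k xs \<subseteq> localized_class F X l P k xs"
proof
  fix f assume f: "f \<in> future_minimizers F X l k xs"
  \<comment> \<open>Every real \<open>r\<close> competing in the infimum is at least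
    \<open>P f xs\<close>, so the infimum is too, whether or not it is attained. If no
    \<open>r\<close> competes, the infimum is \<open>\<infinity>\<close> and the bound is
    trivial.\<close>
  then have "ereal (P f xs) \<le> local_radius F X l P k xs"
    unfolding local_radius_def by (auto intro!: Inf_greatest simp: sublevel_def)
  with f show "f \<in> localized_class F X l P k xs"
    by (simp add: localized_class_def sublevel_def future_minimizers_def)
qed

text \<open>The moves \<open>ys\<close> that really follow \<open>xs\<close> serve as the
  hypothetical future in the definition of \<open>future_minimizers\<close>.\<close>

lemma arg_min_in_localized_class:
  assumes "is_arg_min (\<lambda>f. cum_loss l f (xs @ ys)) (\<lambda>f. f \<in> F) f" and "ys \<in> lists X"
  shows "f \<in> localized_class F X l P (length ys) xs"
proof -
  from assms(1) have "f \<in> F" "\<And>g. g \<in> F \<Longrightarrow> cum_loss l f (xs @ ys) \<le> cum_loss l g (xs @ ys)"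
    by (auto simp: is_arg_min_linorder)
  then have "ereal (cum_loss l f (xs @ ys)) = (INF g\<in>F. ereal (cum_loss l g (xs @ ys)))"
    by (intro antisym INF_greatest INF_lower) auto
  with \<open>f \<in> F\<close> assms(2) have "f \<in> future_minimizers F X l (length ys) xs"
    by (auto simp: future_minimizers_def)
  then show ?thesis
    by (rule subsetD[OF future_minimizers_subset_localized_class])
qed

lemma block_class_subset: "block_class F X l P k x i \<subseteq> F"
  by (auto simp: block_class_def localized_class_def sublevel_def)

section \<open>Regret of the meta-algorithm within one block\<close>

lemma met_algo_step:
  assumes "admissible M X l Rel" "G \<subseteq> space M" "zs \<in> lists X" "length zs < k"
    and "met_algo_move M X l Rel k G zs q" "z \<in> X"
  shows "ereal (\<integral>f. l f z \<partial>q) + Rel k G (zs @ [z]) \<le> Rel k G zs"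
proof -
  have "ereal (\<integral>f. l f z \<partial>q) + Rel k G (zs @ [z]) \<le> meta_objective X l (Rel k G) zs q"
    unfolding meta_objective_def using assms(6) by (rule SUP_upper)
  \<comment> \<open>A minimizing \<open>q\<close> attains the infimum, which is the quantity that
    admissibility bounds by the current value of the relaxation.\<close>
  also have "\<dots> \<le> (INF q\<in>distributions M X l G. meta_objective X l (Rel k G) zs q)"
    using assms(5) by (auto simp: met_algo_move_def is_arg_min_linorder intro!: INF_greatest)
  also have "\<dots> \<le> Rel k G zs"
    using assms(1-4) by (auto simp: admissible_def)
  finally show ?thesis .
qed

text \<open>The horizon \<open>k\<close> stays fixed while \<open>j\<close> counts the rounds
  already played: each step trades one expected loss for one more entry in the history.\<close>

lemma met_algo_telescope:
  assumes adm: "admissible M X l Rel" and G: "G \<subseteq> space M"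
    and X: "\<And>t. a < t \<Longrightarrow> t \<le> a + k \<Longrightarrow> x t \<in> X"
    and move: "\<And>j. j < k \<Longrightarrow> met_algo_move M X l Rel k G (segment x a (a + j)) (q (a + j + 1))"
    and "j \<le> k"
  shows "ereal (\<Sum>t\<in>{a<..a + j}. \<integral>f. l f (x t) \<partial>q t) + Rel k G (segment x a (a + j)) \<le> Rel k G []"
  using \<open>j \<le> k\<close>
proof (induction j)
  case 0
  then show ?case by (simp add: segment_def)
next
  case (Suc j)
  let ?S = "\<Sum>t\<in>{a<..a + j}. \<integral>f. l f (x t) \<partial>q t"
  let ?E = "\<integral>f. l f (x (Suc (a + j))) \<partial>q (Suc (a + j))"
  have "{a<..a + Suc j} = insert (Suc (a + j)) {a<..a + j}"
    by auto
  then have sum: "(\<Sum>t\<in>{a<..a + Suc j}. \<integral>f. l f (x t) \<partial>q t) = ?S + ?E"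
    by simp
  have "ereal (\<Sum>t\<in>{a<..a + Suc j}. \<integral>f. l f (x t) \<partial>q t) + Rel k G (segment x a (a + Suc j))
      = ereal ?S + (ereal ?E + Rel k G (segment x a (a + j) @ [x (Suc (a + j))]))"
    \<comment> \<open>\<open>Rel\<close> may be infinite, so the step only regroups and compares
      sums; nothing is subtracted or cancelled.\<close>
    unfolding sum plus_ereal.simps(1)[symmetric] add.assoc by (simp add: segment_Suc)
  also have "\<dots> \<le> ereal ?S + Rel k G (segment x a (a + j))"
    using Suc.prems move[of j] X
    by (intro add_left_mono met_algo_step[OF adm G]) (auto intro!: segment_in_lists)
  also have "\<dots> \<le> Rel k G []"
    using Suc by simp
  finally show ?case .
qed

text \<open>After \<open>k\<close> rounds the terminal condition of admissibility turns the
  relaxation into minus the best loss of the block, to which \<open>g\<close> is compared.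
  Positivity of \<open>k\<close> is there because \<open>admissible\<close> speaks of horizons from
  1 on.\<close>

lemma met_algo_regret:
  assumes adm: "admissible M X l Rel" and G: "G \<subseteq> space M" and "k > 0"
    and X: "\<And>t. a < t \<Longrightarrow> t \<le> a + k \<Longrightarrow> x t \<in> X"
    and move: "\<And>j. j < k \<Longrightarrow> met_algo_move M X l Rel k G (segment x a (a + j)) (q (a + j + 1))"
    and "g \<in> G"
  shows "ereal ((\<Sum>t\<in>{a<..a + k}. \<integral>f. l f (x t) \<partial>q t) - (\<Sum>t\<in>{a<..a + k}. l g (x t)))
    \<le> Rel k G []"
proof -
  let ?zs = "segment x a (a + k)"
  have "ereal ((\<Sum>t\<in>{a<..a + k}. \<integral>f. l f (x t) \<partial>q t) - (\<Sum>t\<in>{a<..a + k}. l g (x t)))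
      = ereal (\<Sum>t\<in>{a<..a + k}. \<integral>f. l f (x t) \<partial>q t) + - ereal (cum_loss l g ?zs)"
    by (simp add: cum_loss_segment)
  also have "\<dots> \<le> ereal (\<Sum>t\<in>{a<..a + k}. \<integral>f. l f (x t) \<partial>q t)
      + - (INF f\<in>G. ereal (cum_loss l f ?zs))"
    using \<open>g \<in> G\<close> by (intro add_left_mono) (auto simp only: ereal_minus_le_minus intro: INF_lower)
  also have "\<dots> \<le> ereal (\<Sum>t\<in>{a<..a + k}. \<integral>f. l f (x t) \<partial>q t) + Rel k G ?zs"
  proof (rule add_left_mono)
    have "?zs \<in> lists X"
      using X by (rule segment_in_lists)
    with adm G \<open>k > 0\<close> show "- (INF f\<in>G. ereal (cum_loss l f ?zs)) \<le> Rel k G ?zs"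
      by (auto simp: admissible_def)
  qed
  also have "\<dots> \<le> Rel k G []"
    using met_algo_telescope[OF adm G X move] by blast
  finally show ?thesis .
qed

section \<open>Chaining the blocks\<close>

lemma localized_meta_regret:
  assumes adm: "admissible M X l Rel"
    and pos: "\<forall>i\<in>{1..m}. k i > 0"
    and X: "\<forall>t\<in>{1..block_end k m}. x t \<in> X"
    and arg_min: "\<forall>i\<in>{1..m}. \<exists>f. is_arg_min (\<lambda>f. cum_loss l f (segment x 0 (block_end k i)))
                                    (\<lambda>f. f \<in> space M) f"
    and run: "localized_meta_run M X l P Rel m k x q"
    and "n \<le> m" "g \<in> space M"
  shows "ereal ((\<Sum>t=1..block_end k n. \<integral>f. l f (x t) \<partial>q t) - (\<Sum>t=1..block_end k n. l g (x t)))
    \<le> (\<Sum>i=1..n. Rel (k i) (block_class (space M) X l P k x i) [])"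
  using \<open>n \<le> m\<close> \<open>g \<in> space M\<close>
\<comment> \<open>The comparator is generalized because the hypothesis for the earlier blocks is
  applied to the minimizer \<open>f\<close> at the end of the new block, not to
  \<open>g\<close>.\<close>
proof (induction n arbitrary: g)
  case 0
  then show ?case by simp
next
  case (Suc n)
  let ?i = "Suc n" and ?a = "block_end k n"
  let ?b = "?a + k ?i"
  let ?G = "block_class (space M) X l P k x ?i"
  let ?E = "\<lambda>t. \<integral>f. l f (x t) \<partial>q t"
  have i: "?i \<in> {1..m}" using Suc.prems by simp
  have "?b \<le> block_end k m"
    using block_end_mono[OF Suc.prems(1), of k] by simp
  then have X': "x t \<in> X" if "?a < t" "t \<le> ?b" for t
    using X that by auto
  have split: "(\<Sum>t=1..?b. h t) = (\<Sum>t=1..?a. h t) + (\<Sum>t\<in>{?a<..?b}. h t)" for h :: "nat \<Rightarrow> real"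
    by (subst sum.union_disjoint[symmetric]) (auto intro!: sum.cong)
  obtain f where f: "is_arg_min (\<lambda>f. cum_loss l f (segment x 0 ?b)) (\<lambda>f. f \<in> space M) f"
    using arg_min i by fastforce
  then have "f \<in> space M" and "cum_loss l f (segment x 0 ?b) \<le> cum_loss l g (segment x 0 ?b)"
    using Suc.prems by (auto simp: is_arg_min_linorder)
  then have le: "(\<Sum>t=1..?b. l f (x t)) \<le> (\<Sum>t=1..?b. l g (x t))"
    by (simp add: cum_loss_segment flip: atLeastSucAtMost_greaterThanAtMost)
  have "f \<in> ?G"
    using arg_min_in_localized_class[of l "segment x 0 ?a" "segment x ?a ?b" "space M" f X P] f X'
    by (simp add: block_class_def segment_in_lists flip: segment_append)
  then have block: "ereal ((\<Sum>t\<in>{?a<..?b}. ?E t) - (\<Sum>t\<in>{?a<..?b}. l f (x t))) \<le> Rel (k ?i) ?G []"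
  proof (intro met_algo_regret[OF adm block_class_subset])
    show "k ?i > 0" using pos i by blast
    show "met_algo_move M X l Rel (k ?i) ?G (segment x ?a (?a + j)) (q (?a + j + 1))"
      if "j < k ?i" for j
      using run[unfolded localized_meta_run_def, rule_format, OF i that] by simp
  qed (use X' in auto)
  \<comment> \<open>Passing from \<open>g\<close> to \<open>f\<close> on all rounds up to
    \<open>?b\<close> only increases the regret; the sums for \<open>f\<close> then split at
    \<open>?a\<close> into past and new block.\<close>
  have "ereal ((\<Sum>t=1..?b. ?E t) - (\<Sum>t=1..?b. l g (x t)))
      \<le> ereal ((\<Sum>t=1..?a. ?E t) - (\<Sum>t=1..?a. l f (x t)))
        + ereal ((\<Sum>t\<in>{?a<..?b}. ?E t) - (\<Sum>t\<in>{?a<..?b}. l f (x t)))"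
    using le unfolding plus_ereal.simps ereal_less_eq split by linarith
  also have "\<dots> \<le> (\<Sum>i=1..n. Rel (k i) (block_class (space M) X l P k x i) []) + Rel (k ?i) ?G []"
    using Suc.prems by (intro add_mono block Suc.IH \<open>f \<in> space M\<close>) auto
  finally show ?case by simp
qed

section \<open>From the chosen distributions to the expected regret\<close>

lemma localized_meta_run_distribution:
  assumes "localized_meta_run M X l P Rel m k x q" "t \<in> {1..block_end k m}"
  obtains G where "q t \<in> distributions M X l G"
proof -
  obtain i j where "i \<in> {1..m}" "j < k i" "t = block_end k (i - 1) + j + 1"
    using in_some_block[OF assms(2)] .
  with assms(1) have "met_algo_move M X l Rel (k i) (block_class (space M) X l P k x i)
      (segment x (block_end k (i - 1)) (block_end k (i - 1) + j)) (q t)"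
    unfolding localized_meta_run_def by blast
  then show thesis
    using that by (auto simp: met_algo_move_def is_arg_min_def)
qed

lemma
  fixes h :: "'i \<Rightarrow> 'a \<Rightarrow> real"
  assumes "finite I" "\<And>i. i \<in> I \<Longrightarrow> prob_space (q i)" "i \<in> I" "integrable (q i) (h i)"
  shows integrable_PiM_coordinate: "integrable (PiM I q) (\<lambda>f. h i (f i))"
    and integral_PiM_coordinate: "(\<integral>f. h i (f i) \<partial>PiM I q) = (\<integral>y. h i y \<partial>q i)"
proof -
  \<comment> \<open>Projection to a coordinate pushes the product measure forward to that factor, so
    both claims are changes of variables.\<close>
  have distr: "distr (PiM I q) (q i) (\<lambda>f. f i) = q i"
    using assms by (intro distr_PiM_component) auto
  have meas: "(\<lambda>f. f i) \<in> measurable (PiM I q) (q i)"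
    using assms(3) by simp
  show "integrable (PiM I q) (\<lambda>f. h i (f i))"
    using integrable_distr[OF meas, of "h i"] assms(4) by (simp add: distr)
  show "(\<integral>f. h i (f i) \<partial>PiM I q) = (\<integral>y. h i y \<partial>q i)"
    using integral_distr[OF meas, of "h i"] assms(4) by (simp add: distr)
qed

lemma integral_PiM_sum_diff:
  fixes h :: "'i \<Rightarrow> 'a \<Rightarrow> real"
  assumes "finite I" "\<And>i. i \<in> I \<Longrightarrow> prob_space (q i)" "\<And>i. i \<in> I \<Longrightarrow> integrable (q i) (h i)"
  shows "(\<integral>f. (\<Sum>i\<in>I. h i (f i)) - c \<partial>PiM I q) = (\<Sum>i\<in>I. \<integral>y. h i y \<partial>q i) - c"
proof -
  \<comment> \<open>Total mass 1 makes the constant \<open>c\<close> integrate to itself.\<close>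
  interpret prob_space "PiM I q"
    using assms(2) by (rule prob_space_PiM)
  show ?thesis
    using assms by (simp add: integrable_PiM_coordinate integral_PiM_coordinate prob_space)
qed

text \<open>The comparator term of the regret does not depend on the learner's draws, so it plays
  the part of the constant.\<close>

lemma expected_regret_eq:
  assumes "\<And>t. t \<in> {1..T} \<Longrightarrow> prob_space (q t)"
    and "\<And>t. t \<in> {1..T} \<Longrightarrow> integrable (q t) (\<lambda>f. l f (x t))"
  shows "expected_regret F l T q x =
    (\<Sum>t=1..T. \<integral>f. l f (x t) \<partial>q t) - (INF g\<in>F. \<Sum>t=1..T. l g (x t))"
  unfolding expected_regret_def regret_def
  using assms by (intro integral_PiM_sum_diff) auto

theorem lemma5:
  fixes M :: "'f measure" and X :: "'x set" and l :: "'f \<Rightarrow> 'x \<Rightarrow> real"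
    and P :: "'f \<Rightarrow> 'x list \<Rightarrow> real" and Rel :: "('f, 'x) relaxation"
    and m T :: nat and k :: "nat \<Rightarrow> nat" and x :: "nat \<Rightarrow> 'x" and q :: "nat \<Rightarrow> 'f measure"
  assumes "space M \<noteq> {}"
    and "admissible M X l Rel"
    and "\<forall>i\<in>{1..m}. k i > 0"
    and "block_end k m = T"
    and "\<forall>t\<in>{1..T}. x t \<in> X"
    and "\<forall>i\<in>{1..m}. \<exists>f. is_arg_min (\<lambda>f. cum_loss l f (segment x 0 (block_end k i)))
                                    (\<lambda>f. f \<in> space M) f"
    and "localized_meta_run M X l P Rel m k x q"
  shows "ereal (expected_regret (space M) l T q x)
           \<le> (\<Sum>i=1..m. Rel (k i) (block_class (space M) X l P k x i) [])"
proof -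
  have q: "prob_space (q t)" "integrable (q t) (\<lambda>f. l f (x t))" if t: "t \<in> {1..T}" for t
  proof -
    obtain G where "q t \<in> distributions M X l G"
      using localized_meta_run_distribution assms(4,7) t by blast
    then show "prob_space (q t)" "integrable (q t) (\<lambda>f. l f (x t))"
      using assms(5) t by (auto simp: distributions_def)
  qed
  obtain g where "g \<in> space M"
    and min: "\<And>f. f \<in> space M \<Longrightarrow> (\<Sum>t=1..T. l g (x t)) \<le> (\<Sum>t=1..T. l f (x t))"
  \<comment> \<open>Without blocks the minimizer assumption is vacuous, but all sums are empty and
    any point of the nonempty \<open>space M\<close> will do. Otherwise the minimizer at the end of
    block \<open>m\<close> is taken.\<close>
  proof (cases "m = 0")
    case True
    then have "T = 0" using assms(4) by simp
    with assms(1) that show thesis by auto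
  next
    case False
    then obtain g where "is_arg_min (\<lambda>f. cum_loss l f (segment x 0 T)) (\<lambda>f. f \<in> space M) g"
      using assms(4,6) by fastforce
    then show thesis
      using that
      by (auto simp: is_arg_min_linorder cum_loss_segment
          simp flip: atLeastSucAtMost_greaterThanAtMost)
  qed
  \<comment> \<open>Since the minimum is attained, the real infimum in \<open>regret\<close> has its
    intended value.\<close>
  have "(INF f\<in>space M. \<Sum>t=1..T. l f (x t)) = (\<Sum>t=1..T. l g (x t))"
    using \<open>g \<in> space M\<close> min by (intro cInf_eq_minimum) auto
  then have "expected_regret (space M) l T q x =
      (\<Sum>t=1..T. \<integral>f. l f (x t) \<partial>q t) - (\<Sum>t=1..T. l g (x t))"
    using expected_regret_eq[of T q l x "space M"] q by simp
  then show ?thesis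
    using localized_meta_regret[OF assms(2,3) _ assms(6,7) order_refl \<open>g \<in> space M\<close>] assms(4,5)
    by simp
qed

end
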